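(* Let $I$ be a set and let $F:[0,+\infty)^I\to[0,+\infty)$ be a function. The following statements are equivalent: (1) $F$ is a quasi-pseudometric aggregation function on products; (2) $F$ is a quasi-pseudometric aggregation function on sets; (3) $F$ is isotone, subadditive and $F((0)_{i\in I})=0$; (4) $F$ preserves asymmetric triangle triplets and $F((0)_{i\in I})=0$.
   Context: $[0,+\infty)^I$ carries the componentwise order $\leq$ and componentwise addition. $F$ is *isotone* if $x\leq y$ implies $F(x)\leq F(y)$; $F$ is *subadditive* if $F(x+y)\leq F(x)+F(y)$ for all $x,y\in[0,+\infty)^I$. A triplet $(x,y,z)$ of elements of $[0,+\infty)^I$ (or of $[0,+\infty)$) is an *asymmetric triangle triplet* if $z\leq x+y$. $F$ *preserves asymmetric triangle triplets* if $(F(x),F(y),F(z))$ is an asymmetric triangle triplet whenever $(x,y,z)$ is one. A quasi-pseudometric on a nonempty set $X$ is a map $d:X\times X\to[0,+\infty)$ with $d(x,x)=0$ and $d(x,y)\leq d(x,z)+d(z,y)$ for all $x,y,z\in X$. $F$ is a *quasi-pseudometric aggregation function on products* if for every family $\{(X_i,d_i):i\in I\}$ of quasi-pseudometric spaces, $(x,y)\mapsto F((d_i(x_i,y_i))_{i\in I})$ is a quasi-pseudometric on $\prod_{i\in I}X_i$. It is a *quasi-pseudometric aggregation function on sets* if for every nonempty set $X$ and every family $\{d_i:i\in I\}$ of quasi-pseudometrics on $X$, $(x,y)\mapsto F((d_i(x,y))_{i\in I})$ is a quasi-pseudometric on $X$. *)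

theory Defs
  imports Complex_Main "HOL-Library.FuncSet"
begin

text \<open>
  The index set is an arbitrary, possibly empty, set \<open>I\<close>.  An element of
  \<open>[0,\<infinity>)\<^sup>I\<close> is a function that is \<open>undefined\<close> outside \<open>I\<close>, so that there is exactly one
  representative for each family.
\<close>

definition nonneg_fams :: "'i set \<Rightarrow> ('i \<Rightarrow> real) set" where
  "nonneg_fams I = (\<Pi>\<^sub>E i\<in>I. {0..})"

definition fam_le :: "'i set \<Rightarrow> ('i \<Rightarrow> real) \<Rightarrow> ('i \<Rightarrow> real) \<Rightarrow> bool" where
  "fam_le I x y \<longleftrightarrow> (\<forall>i\<in>I. x i \<le> y i)"

definition fam_add :: "'i set \<Rightarrow> ('i \<Rightarrow> real) \<Rightarrow> ('i \<Rightarrow> real) \<Rightarrow> ('i \<Rightarrow> real)" where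
  "fam_add I x y = (\<lambda>i\<in>I. x i + y i)"

definition fam_zero :: "'i set \<Rightarrow> ('i \<Rightarrow> real)" where
  "fam_zero I = (\<lambda>i\<in>I. 0)"

definition isotone_fam :: "'i set \<Rightarrow> (('i \<Rightarrow> real) \<Rightarrow> real) \<Rightarrow> bool" where
  "isotone_fam I F \<longleftrightarrow>
     (\<forall>x\<in>nonneg_fams I. \<forall>y\<in>nonneg_fams I. fam_le I x y \<longrightarrow> F x \<le> F y)"

definition subadditive_fam :: "'i set \<Rightarrow> (('i \<Rightarrow> real) \<Rightarrow> real) \<Rightarrow> bool" where
  "subadditive_fam I F \<longleftrightarrow>
     (\<forall>x\<in>nonneg_fams I. \<forall>y\<in>nonneg_fams I. F (fam_add I x y) \<le> F x + F y)"

definition asym_triangle_triplet :: "real \<Rightarrow> real \<Rightarrow> real \<Rightarrow> bool" where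
  "asym_triangle_triplet a b c \<longleftrightarrow> 0 \<le> a \<and> 0 \<le> b \<and> 0 \<le> c \<and> c \<le> a + b"

definition asym_triangle_triplet_fam ::
    "'i set \<Rightarrow> ('i \<Rightarrow> real) \<Rightarrow> ('i \<Rightarrow> real) \<Rightarrow> ('i \<Rightarrow> real) \<Rightarrow> bool" where
  "asym_triangle_triplet_fam I x y z \<longleftrightarrow>
     x \<in> nonneg_fams I \<and> y \<in> nonneg_fams I \<and> z \<in> nonneg_fams I \<and> fam_le I z (fam_add I x y)"

definition preserves_asym_triangle_triplets :: "'i set \<Rightarrow> (('i \<Rightarrow> real) \<Rightarrow> real) \<Rightarrow> bool" where
  "preserves_asym_triangle_triplets I F \<longleftrightarrow>
     (\<forall>x y z. asym_triangle_triplet_fam I x y z \<longrightarrow> asym_triangle_triplet (F x) (F y) (F z))"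

text \<open>The values of \<open>d\<close> outside \<open>X \<times> X\<close> are irrelevant.\<close>

definition quasi_pseudometric_on :: "'a set \<Rightarrow> ('a \<Rightarrow> 'a \<Rightarrow> real) \<Rightarrow> bool" where
  "quasi_pseudometric_on X d \<longleftrightarrow>
     X \<noteq> {} \<and>
     (\<forall>x\<in>X. \<forall>y\<in>X. 0 \<le> d x y) \<and>
     (\<forall>x\<in>X. d x x = 0) \<and>
     (\<forall>x\<in>X. \<forall>y\<in>X. \<forall>z\<in>X. d x y \<le> d x z + d z y)"

text \<open>
  HOL cannot quantify over all sets of all types inside a formula.  The type argument names the
  type whose subsets serve as the underlying sets of the spaces; these subsets may be of any
  size and may differ from index to index.
\<close>

definition qpm_aggregation_on_products ::
    "'a itself \<Rightarrow> 'i set \<Rightarrow> (('i \<Rightarrow> real) \<Rightarrow> real) \<Rightarrow> bool" where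
  "qpm_aggregation_on_products (_ :: 'a itself) I F \<longleftrightarrow>
     (\<forall>(X :: 'i \<Rightarrow> 'a set) (d :: 'i \<Rightarrow> 'a \<Rightarrow> 'a \<Rightarrow> real).
        (\<forall>i\<in>I. quasi_pseudometric_on (X i) (d i)) \<longrightarrow>
        quasi_pseudometric_on (\<Pi>\<^sub>E i\<in>I. X i) (\<lambda>x y. F (\<lambda>i\<in>I. d i (x i) (y i))))"

definition qpm_aggregation_on_sets ::
    "'a itself \<Rightarrow> 'i set \<Rightarrow> (('i \<Rightarrow> real) \<Rightarrow> real) \<Rightarrow> bool" where
  "qpm_aggregation_on_sets (_ :: 'a itself) I F \<longleftrightarrow>
     (\<forall>(X :: 'a set) (d :: 'i \<Rightarrow> 'a \<Rightarrow> 'a \<Rightarrow> real).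
        X \<noteq> {} \<and> (\<forall>i\<in>I. quasi_pseudometric_on X (d i)) \<longrightarrow>
        quasi_pseudometric_on X (\<lambda>x y. F (\<lambda>i\<in>I. d i x y)))"

end

theory Submission
  imports Defs
begin

text \<open>
  Statement (4) is what the triangle inequality of \<open>F \<circ> d\<close> asks of the triples of distances
  \<open>(d x z, d z y, d x y)\<close>, and three points are enough to realise every asymmetric triangle triplet
  as such a triple.  Aggregation on products restricts to aggregation on sets along the diagonal.
\<close>

lemma fam_zero_in_nonneg_fams: "fam_zero I \<in> nonneg_fams I"
  by (auto simp: fam_zero_def nonneg_fams_def)

lemma fam_add_in_nonneg_fams:
  "x \<in> nonneg_fams I \<Longrightarrow> y \<in> nonneg_fams I \<Longrightarrow> fam_add I x y \<in> nonneg_fams I"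
  by (fastforce simp: fam_add_def nonneg_fams_def PiE_iff)

text \<open>A triplet inequality splits at \<open>fam_add I x y\<close>: isotonicity handles the
  step from \<open>z\<close> up to the sum, subadditivity the step from the sum to
  \<open>F x + F y\<close>. Conversely, each property is the triplet condition at one special
  triplet.\<close>

lemma isotone_subadditive_iff_preserves_triplets:
  assumes F: "F \<in> nonneg_fams I \<rightarrow> {0..}" and F0: "F (fam_zero I) = 0"
  shows "isotone_fam I F \<and> subadditive_fam I F \<longleftrightarrow> preserves_asym_triangle_triplets I F"
proof
  assume *: "isotone_fam I F \<and> subadditive_fam I F"
  show "preserves_asym_triangle_triplets I F"
    unfolding preserves_asym_triangle_triplets_def asym_triangle_triplet_fam_def
      asym_triangle_triplet_def
  proof (intro allI impI)
    fix x y z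
    assume xyz: "x \<in> nonneg_fams I \<and> y \<in> nonneg_fams I \<and> z \<in> nonneg_fams I \<and>
      fam_le I z (fam_add I x y)"
    then have "F z \<le> F (fam_add I x y)"
      using * fam_add_in_nonneg_fams[of x I y] by (auto simp: isotone_fam_def)
    also have "\<dots> \<le> F x + F y"
      using * xyz by (auto simp: subadditive_fam_def)
    finally show "0 \<le> F x \<and> 0 \<le> F y \<and> 0 \<le> F z \<and> F z \<le> F x + F y"
      using F xyz by (auto simp: Pi_iff)
  qed
next
  assume "preserves_asym_triangle_triplets I F"
  then have P: "F z \<le> F x + F y"
    if "x \<in> nonneg_fams I" "y \<in> nonneg_fams I" "z \<in> nonneg_fams I" "fam_le I z (fam_add I x y)"
    for x y z
    using that unfolding preserves_asym_triangle_triplets_def asym_triangle_triplet_fam_def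
      asym_triangle_triplet_def by blast
  \<comment> \<open>The triplet \<open>(y, 0, x)\<close>: its second entry contributes
    \<open>F (fam_zero I) = 0\<close>.\<close>
  have "F x \<le> F y" if "x \<in> nonneg_fams I" "y \<in> nonneg_fams I" "fam_le I x y" for x y
    using P[of y "fam_zero I" x] that F0 fam_zero_in_nonneg_fams[of I]
    by (auto simp: fam_le_def fam_add_def fam_zero_def)
  moreover have "F (fam_add I x y) \<le> F x + F y"
    if "x \<in> nonneg_fams I" "y \<in> nonneg_fams I" for x y
    using P[of x y "fam_add I x y"] that fam_add_in_nonneg_fams[of x I y]
    by (auto simp: fam_le_def)
  ultimately show "isotone_fam I F \<and> subadditive_fam I F"
    by (auto simp: isotone_fam_def subadditive_fam_def)
qed

lemma preserves_triplets_imp_aggregation_on_products: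
  fixes I :: "'i set" and F :: "('i \<Rightarrow> real) \<Rightarrow> real"
  assumes P: "preserves_asym_triangle_triplets I F" and F0: "F (fam_zero I) = 0"
    and F: "F \<in> nonneg_fams I \<rightarrow> {0..}"
  shows "qpm_aggregation_on_products TYPE('a) I F"
  unfolding qpm_aggregation_on_products_def
proof (intro allI impI)
  fix X :: "'i \<Rightarrow> 'a set" and d :: "'i \<Rightarrow> 'a \<Rightarrow> 'a \<Rightarrow> real"
  assume d: "\<forall>i\<in>I. quasi_pseudometric_on (X i) (d i)"
  let ?D = "\<lambda>x y. \<lambda>i\<in>I. d i (x i) (y i)"
  have nn: "?D x y \<in> nonneg_fams I" if "x \<in> Pi\<^sub>E I X" "y \<in> Pi\<^sub>E I X" for x y
    using d that by (auto simp: nonneg_fams_def quasi_pseudometric_on_def PiE_iff)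
  \<comment> \<open>The axiom of choice enters here through \<open>PiE_eq_empty_iff\<close>; for
    empty \<open>I\<close> the product is a single point.\<close>
  have "Pi\<^sub>E I X \<noteq> {}"
    using d by (auto simp: PiE_eq_empty_iff quasi_pseudometric_on_def)
  moreover have "0 \<le> F (?D x y)" if "x \<in> Pi\<^sub>E I X" "y \<in> Pi\<^sub>E I X" for x y
    using nn[OF that] F by auto
  moreover have "F (?D x x) = 0" if "x \<in> Pi\<^sub>E I X" for x
  proof -
    have "?D x x = fam_zero I"
      using d that by (auto simp: fam_zero_def quasi_pseudometric_on_def PiE_iff fun_eq_iff)
    then show ?thesis using F0 by simp
  qed
  moreover have "F (?D x y) \<le> F (?D x z) + F (?D z y)"
    if xyz: "x \<in> Pi\<^sub>E I X" "y \<in> Pi\<^sub>E I X" "z \<in> Pi\<^sub>E I X" for x y z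
  proof -
    have "fam_le I (?D x y) (fam_add I (?D x z) (?D z y))"
      using d xyz by (auto simp: fam_le_def fam_add_def quasi_pseudometric_on_def PiE_iff)
    then have "asym_triangle_triplet_fam I (?D x z) (?D z y) (?D x y)"
      using nn xyz by (simp add: asym_triangle_triplet_fam_def)
    then have "asym_triangle_triplet (F (?D x z)) (F (?D z y)) (F (?D x y))"
      using P unfolding preserves_asym_triangle_triplets_def by blast
    then show ?thesis
      by (simp add: asym_triangle_triplet_def)
  qed
  ultimately show "quasi_pseudometric_on (Pi\<^sub>E I X) (\<lambda>x y. F (?D x y))"
    unfolding quasi_pseudometric_on_def by (intro conjI ballI)
qed

text \<open>The pullback of a quasi-pseudometric along any map is again one. Here the map is the
  diagonal \<open>c\<close>, into the product of copies of \<open>X\<close>.\<close>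

lemma aggregation_on_products_imp_sets:
  fixes I :: "'i set" and F :: "('i \<Rightarrow> real) \<Rightarrow> real"
  assumes "qpm_aggregation_on_products TYPE('a) I F"
  shows "qpm_aggregation_on_sets TYPE('a) I F"
  unfolding qpm_aggregation_on_sets_def
proof (intro allI impI, elim conjE)
  fix X :: "'a set" and d :: "'i \<Rightarrow> 'a \<Rightarrow> 'a \<Rightarrow> real"
  assume X: "X \<noteq> {}" and d: "\<forall>i\<in>I. quasi_pseudometric_on X (d i)"
  let ?G = "\<lambda>x y. F (\<lambda>i\<in>I. d i (x i) (y i))"
  define c :: "'a \<Rightarrow> 'i \<Rightarrow> 'a" where "c = (\<lambda>x. \<lambda>i\<in>I. x)"
  have G: "quasi_pseudometric_on (\<Pi>\<^sub>E i\<in>I. X) ?G"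
    using assms d by (simp add: qpm_aggregation_on_products_def)
  have c: "c x \<in> (\<Pi>\<^sub>E i\<in>I. X)" if "x \<in> X" for x
    using that by (simp add: c_def)
  have eq: "F (\<lambda>i\<in>I. d i x y) = ?G (c x) (c y)" for x y
    by (simp add: c_def cong: restrict_cong)
  show "quasi_pseudometric_on X (\<lambda>x y. F (\<lambda>i\<in>I. d i x y))"
    unfolding eq using X G c unfolding quasi_pseudometric_on_def by blast
qed

text \<open>
  The distances against the order \<open>p, q, r\<close> only have to be large; \<open>x i + y i\<close> is large enough.
\<close>

lemma aggregation_on_sets_imp_preserves_triplets:
  fixes I :: "'i set" and F :: "('i \<Rightarrow> real) \<Rightarrow> real"
  assumes A: "qpm_aggregation_on_sets TYPE('a) I F" and inf: "infinite (UNIV :: 'a set)"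
  shows "preserves_asym_triangle_triplets I F" and "F (fam_zero I) = 0"
proof -
  \<comment> \<open>The infinite type supplies the three distinct points.\<close>
  obtain p q r :: 'a where pqr: "p \<noteq> q" "p \<noteq> r" "q \<noteq> r"
    using infinite_arbitrarily_large[OF inf, of 3] by (auto simp: card_3_iff)
  \<comment> \<open>The first conjunct does not depend on the triplet; it is carried along because
    the same metric on three points yields it, and is extracted at the end from the zero
    triplet.\<close>
  have main: "F (fam_zero I) = 0 \<and> asym_triangle_triplet (F x) (F y) (F z)"
    if xyz: "asym_triangle_triplet_fam I x y z" for x y z
  proof -
    define d :: "'i \<Rightarrow> 'a \<Rightarrow> 'a \<Rightarrow> real" where
      "d i u v = (if u = v then 0 else if (u, v) = (p, q) then x i
        else if (u, v) = (q, r) then y i else if (u, v) = (p, r) then z i else x i + y i)" for i u v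
    have "quasi_pseudometric_on {p, q, r} (d i)" if "i \<in> I" for i
    proof -
      have "0 \<le> x i" "0 \<le> y i" "0 \<le> z i" "z i \<le> x i + y i"
        using xyz that
        by (auto simp: asym_triangle_triplet_fam_def nonneg_fams_def fam_le_def fam_add_def PiE_iff)
      \<comment> \<open>The detour from \<open>p\<close> to \<open>r\<close> through
        \<open>q\<close> costs \<open>x i + y i\<close>, which is at least \<open>z i\<close>. Every
        other detour through a third point has a step against the order, which alone costs
        \<open>x i + y i\<close>, an upper bound for all the distances.\<close>
      then show ?thesis
        using pqr by (simp add: quasi_pseudometric_on_def d_def)
    qed
    then have "quasi_pseudometric_on {p, q, r} (\<lambda>u v. F (\<lambda>i\<in>I. d i u v))"
      using A by (simp add: qpm_aggregation_on_sets_def)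
    \<comment> \<open>These equalities also hold outside \<open>I\<close>, since members of
      \<open>nonneg_fams I\<close> are \<open>undefined\<close> there.\<close>
    moreover have "(\<lambda>i\<in>I. d i p q) = x" "(\<lambda>i\<in>I. d i q r) = y" "(\<lambda>i\<in>I. d i p r) = z"
      using xyz pqr
      by (auto simp: d_def asym_triangle_triplet_fam_def nonneg_fams_def PiE_iff
          extensional_def fun_eq_iff)
    moreover have "(\<lambda>i\<in>I. d i p p) = fam_zero I"
      by (simp add: d_def fam_zero_def)
    \<comment> \<open>The triangle inequality from \<open>p\<close> to \<open>r\<close> through
      \<open>q\<close> reads \<open>F z \<le> F x + F y\<close>, and the zero distance from
      \<open>p\<close> to itself reads \<open>F (fam_zero I) = 0\<close>.\<close>
    ultimately show ?thesis
      unfolding quasi_pseudometric_on_def asym_triangle_triplet_def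
      by (metis insert_iff)
  qed
  show "preserves_asym_triangle_triplets I F"
    using main by (simp add: preserves_asym_triangle_triplets_def)
  have "asym_triangle_triplet_fam I (fam_zero I) (fam_zero I) (fam_zero I)"
    using fam_zero_in_nonneg_fams[of I]
    by (simp add: asym_triangle_triplet_fam_def fam_le_def fam_add_def fam_zero_def)
  then show "F (fam_zero I) = 0"
    using main by blast
qed

theorem theorem3p16:
  fixes I :: "'i set" and F :: "('i \<Rightarrow> real) \<Rightarrow> real"
  assumes "F \<in> nonneg_fams I \<rightarrow> {0..}"
    and "infinite (UNIV :: 'a set)" and "infinite (UNIV :: 'b set)"
  shows "(qpm_aggregation_on_products TYPE('a) I F \<longleftrightarrow> qpm_aggregation_on_sets TYPE('b) I F) \<and>
         (qpm_aggregation_on_sets TYPE('b) I F \<longleftrightarrow>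
            isotone_fam I F \<and> subadditive_fam I F \<and> F (fam_zero I) = 0) \<and>
         (isotone_fam I F \<and> subadditive_fam I F \<and> F (fam_zero I) = 0 \<longleftrightarrow>
            preserves_asym_triangle_triplets I F \<and> F (fam_zero I) = 0)"
proof -
  \<comment> \<open>The types \<open>'a\<close> and \<open>'b\<close> are unrelated, so products
    over one and sets over the other are compared through \<open>?P\<close>, which mentions neither.
    On each type the implications run in a cycle from \<open>?P\<close> to products to sets and
    back.\<close>
  let ?P = "preserves_asym_triangle_triplets I F \<and> F (fam_zero I) = 0"
  have "qpm_aggregation_on_products TYPE('a) I F \<longleftrightarrow> ?P"
    using preserves_triplets_imp_aggregation_on_products[of I F, where 'a = 'a]
      aggregation_on_products_imp_sets[of I F, where 'a = 'a]
      aggregation_on_sets_imp_preserves_triplets[of I F, where 'a = 'a] assms by blast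
  moreover have "qpm_aggregation_on_sets TYPE('b) I F \<longleftrightarrow> ?P"
    using preserves_triplets_imp_aggregation_on_products[of I F, where 'a = 'b]
      aggregation_on_products_imp_sets[of I F, where 'a = 'b]
      aggregation_on_sets_imp_preserves_triplets[of I F, where 'a = 'b] assms by blast
  moreover have "isotone_fam I F \<and> subadditive_fam I F \<and> F (fam_zero I) = 0 \<longleftrightarrow> ?P"
    using isotone_subadditive_iff_preserves_triplets[of F I] assms(1) by blast
  ultimately show ?thesis by blast
qed

end
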